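(* Let $(\mathbb{X},T)$ be a Polish space and $(\mathbb{X}_n)_{n\ge1}$ a non-decreasing sequence of open subsets with $\bigcup_n\mathbb{X}_n=\mathbb{X}$. Let $(\mu_n)_{n\ge1}$ be a projective system of point processes on $\mathbb{X}_n$ with respect to the restriction maps $\pi_{mn}:M(\mathbb{X}_m)\to M(\mathbb{X}_n)$, and let $\mu_{\mathbb{N}}$ be its projective limit, a point process on $\mathbb{X}$. Let $\langle\Phi_n,\eta_{nm}\rangle_{\mathbb{N}}$ be a compatible direct system of groups acting on $\mathbb{X}_n$, and let $\langle\Phi_\infty,\eta_n\rangle$ be a compatible direct pre-limit group acting on $\mathbb{X}$, such that any probability measure $\mu$ on $(M(\mathbb{X}),\mathcal{M})$ is invariant with respect to $\Phi_\infty$ if $$\mu(A)=\mu\big((\eta_n\varphi_n)^{-1}A\big)\qquad\text{for all } n\ge1,\ \varphi_n\in\Phi_n,\ A\in\mathcal{M}.$$ If $\mu_n$ is invariant with respect to $\Phi_n$ for every $n\ge1$, then $\mu_{\mathbb{N}}$ is invariant with respect to $\Phi_\infty$.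
   Context: For a Polish space $\mathbb{Y}$ with Borel $\sigma$-algebra $\mathcal{Y}$, $M(\mathbb{Y})$ denotes the set of locally finite simple counting measures on $\mathbb{Y}$: Borel measures $\xi$ with values in $\{0,1,2,\dots\}\cup\{\infty\}$ such that every point has an open neighbourhood of finite $\xi$-measure, and $\xi(\{y\})\le1$ for every $y$. It carries the $\sigma$-algebra generated by the maps $\xi\mapsto\xi(A)$, $A\in\mathcal{Y}$, denoted $\mathcal{M}$ for $\mathbb{Y}=\mathbb{X}$ and $\mathcal{M}_n$ for $\mathbb{Y}=\mathbb{X}_n$. A point process on $\mathbb{Y}$ is a probability measure on $M(\mathbb{Y})$. Each $\mathbb{X}_n$ has the subspace topology. With inclusions $\iota_{nm}:\mathbb{X}_n\hookrightarrow\mathbb{X}_m$ and $\iota_n:\mathbb{X}_n\hookrightarrow\mathbb{X}$, the projections are $\pi_{mn}\xi(A_n)=\xi(\iota_{nm}(A_n))$ and $\pi_n\xi(A_n)=\xi(\iota_n(A_n))$ for Borel $A_n\subseteq\mathbb{X}_n$. A projective system of point processes satisfies $\mu_n=\pi_{mn}*\mu_m$ (push-forward) for $n\le m$; its projective limit $\mu_{\mathbb{N}}$ is the unique probability measure on $(M(\mathbb{X}),\mathcal{M})$ with $\pi_n*\mu_{\mathbb{N}}=\mu_n$ for all $n$. A direct system of groups consists of groups $\Phi_n$ and homomorphisms $\eta_{nm}:\Phi_n\to\Phi_m$ ($n\le m$) with $\eta_{nn}=\mathrm{id}$ and $\eta_{nk}=\eta_{mk}\circ\eta_{nm}$ for $n\le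 m\le k$. A direct pre-limit is a group $\Phi_\infty$ with homomorphisms $\eta_n:\Phi_n\to\Phi_\infty$ satisfying $\eta_n=\eta_m\circ\eta_{nm}$ for $n\le m$. A group $\Phi$ acts measurably on a measurable space $\mathbb{Y}$ if $\varphi^{-1}A$ is measurable for every $\varphi\in\Phi$ and measurable $A$. The groups $\Phi_n$ and $\Phi_\infty$ act measurably on $\mathbb{X}_n$ and $\mathbb{X}$ respectively, and these actions are extended to $M(\mathbb{X}_n)$ and $M(\mathbb{X})$ by $\varphi\xi(A)=\xi(\varphi^{-1}A)$; it is understood that this maps the space of locally finite simple counting measures to itself. A probability measure $\mu$ on a measurable space is invariant with respect to a group acting measurably on it if $\mu(A)=\mu(\varphi^{-1}A)$ for all group elements $\varphi$ and measurable $A$; invariance of $\mu_n$, $\mu_{\mathbb{N}}$ and $\mu$ refers to the extended actions. Compatible direct system: $\pi_{mn}((\eta_{nm}\varphi_n)\xi)=\varphi_n(\pi_{mn}\xi)$ for all $n\le m$, $\varphi_n\in\Phi_n$, $\xi\in M(\mathbb{X}_m)$. Compatible direct pre-limit: $\pi_n((\eta_n\varphi_n)\xi)=\varphi_n(\pi_n\xi)$ for all $n\ge1$, $\varphi_n\in\Phi_n$, $\xi\in M(\mathbb{X})$. *)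

theory Defs
  imports "HOL-Probability.Probability" "HOL-Algebra.Group_Action"
begin

definition borel_of :: "'a topology \<Rightarrow> 'a measure" where
  "borel_of Y = sigma (topspace Y) {U. openin Y U}"

definition polish_topology :: "'a topology \<Rightarrow> bool" where
  "polish_topology Y \<longleftrightarrow> completely_metrizable_space Y \<and> separable_space Y"

text \<open>The space \<open>M(Y)\<close> of locally finite simple counting measures on \<open>Y\<close>. Its elements are
  measures whose measurable structure is the Borel \<open>\<sigma>\<close>-algebra of the topology \<open>Y\<close>.\<close>

definition counting_measures :: "'a topology \<Rightarrow> 'a measure set" where
  "counting_measures Y =
     {\<xi>. sets \<xi> = sets (borel_of Y) \<and>
         (\<forall>A\<in>sets (borel_of Y). emeasure \<xi> A \<in> insert \<infinity> (range of_nat)) \<and>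
         (\<forall>y\<in>topspace Y. \<exists>U. openin Y U \<and> y \<in> U \<and> emeasure \<xi> U < \<infinity>) \<and>
         (\<forall>y\<in>topspace Y. emeasure \<xi> {y} \<le> 1)}"

text \<open>\<open>M(Y)\<close> with the \<open>\<sigma>\<close>-algebra generated by the evaluations \<open>\<xi> \<mapsto> \<xi>(A)\<close>, \<open>A\<close> Borel.\<close>

definition counting_algebra :: "'a topology \<Rightarrow> 'a measure measure" where
  "counting_algebra Y =
     sigma (counting_measures Y)
       {{\<xi> \<in> counting_measures Y. emeasure \<xi> A \<in> B} | A B. A \<in> sets (borel_of Y) \<and> B \<in> sets borel}"

definition point_process :: "'a topology \<Rightarrow> 'a measure measure \<Rightarrow> bool" where
  "point_process Y \<mu> \<longleftrightarrow> prob_space \<mu> \<and> sets \<mu> = sets (counting_algebra Y)"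

text \<open>In the sequel \<open>S n\<close> (for \<open>n \<ge> 1\<close>) is the \<open>n\<close>-th open subset of \<open>X\<close>; its topology is
  \<open>subtopology X (S n)\<close>. As the inclusions are identities on points, the projection of a measure
  to \<open>M(S n)\<close>, from \<open>M(S m)\<close> as well as from \<open>M(X)\<close>, is \<open>\<lambda>\<xi>. restrict_space \<xi> (S n)\<close>.\<close>

definition projective_system ::
    "'a topology \<Rightarrow> (nat \<Rightarrow> 'a set) \<Rightarrow> (nat \<Rightarrow> 'a measure measure) \<Rightarrow> bool" where
  "projective_system X S \<mu> \<longleftrightarrow>
     (\<forall>n\<ge>1. point_process (subtopology X (S n)) (\<mu> n)) \<and>
     (\<forall>n\<ge>1. \<forall>m\<ge>n.
        \<mu> n = distr (\<mu> m) (counting_algebra (subtopology X (S n))) (\<lambda>\<xi>. restrict_space \<xi> (S n)))"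

definition projective_limit ::
    "'a topology \<Rightarrow> (nat \<Rightarrow> 'a set) \<Rightarrow> (nat \<Rightarrow> 'a measure measure) \<Rightarrow> 'a measure measure \<Rightarrow> bool" where
  "projective_limit X S \<mu> \<mu>\<^sub>N \<longleftrightarrow>
     point_process X \<mu>\<^sub>N \<and>
     (\<forall>n\<ge>1.
        distr \<mu>\<^sub>N (counting_algebra (subtopology X (S n))) (\<lambda>\<xi>. restrict_space \<xi> (S n)) = \<mu> n)"

definition acts_measurably ::
    "('g, 'c) monoid_scheme \<Rightarrow> 'b measure \<Rightarrow> ('g \<Rightarrow> 'b \<Rightarrow> 'b) \<Rightarrow> bool" where
  "acts_measurably G N a \<longleftrightarrow> group_action G (space N) a \<and> (\<forall>g\<in>carrier G. a g \<in> measurable N N)"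

text \<open>The extended action \<open>(\<phi> \<xi>)(A) = \<xi>(\<phi>\<^sup>-\<^sup>1 A)\<close> on measures.\<close>

definition extended_action ::
    "'a topology \<Rightarrow> ('g \<Rightarrow> 'a \<Rightarrow> 'a) \<Rightarrow> 'g \<Rightarrow> 'a measure \<Rightarrow> 'a measure" where
  "extended_action Y a g \<xi> = distr \<xi> (borel_of Y) (a g)"

text \<open>A group acting measurably on \<open>Y\<close> whose extended action maps \<open>M(Y)\<close> to itself. The latter
  is not automatic, since a measurable action need not preserve local finiteness.\<close>

definition acts_on_counting_measures ::
    "('g, 'c) monoid_scheme \<Rightarrow> 'a topology \<Rightarrow> ('g \<Rightarrow> 'a \<Rightarrow> 'a) \<Rightarrow> bool" where
  "acts_on_counting_measures G Y a \<longleftrightarrow>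
     acts_measurably G (borel_of Y) a \<and>
     (\<forall>g\<in>carrier G. \<forall>\<xi>\<in>counting_measures Y. extended_action Y a g \<xi> \<in> counting_measures Y)"

definition invariant_under ::
    "('g, 'c) monoid_scheme \<Rightarrow> ('g \<Rightarrow> 'b \<Rightarrow> 'b) \<Rightarrow> 'b measure \<Rightarrow> bool" where
  "invariant_under G a \<mu> \<longleftrightarrow>
     (\<forall>g\<in>carrier G. \<forall>A\<in>sets \<mu>. emeasure \<mu> A = emeasure \<mu> (a g -` A \<inter> space \<mu>))"

definition direct_system ::
    "(nat \<Rightarrow> ('g, 'c) monoid_scheme) \<Rightarrow> (nat \<Rightarrow> nat \<Rightarrow> 'g \<Rightarrow> 'g) \<Rightarrow> bool" where
  "direct_system \<Phi> \<eta> \<longleftrightarrow>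
     (\<forall>n\<ge>1. group (\<Phi> n)) \<and>
     (\<forall>n\<ge>1. \<forall>m\<ge>n. \<eta> n m \<in> hom (\<Phi> n) (\<Phi> m)) \<and>
     (\<forall>n\<ge>1. \<forall>\<phi>\<in>carrier (\<Phi> n). \<eta> n n \<phi> = \<phi>) \<and>
     (\<forall>n\<ge>1. \<forall>m\<ge>n. \<forall>k\<ge>m. \<forall>\<phi>\<in>carrier (\<Phi> n). \<eta> n k \<phi> = \<eta> m k (\<eta> n m \<phi>))"

definition direct_pre_limit ::
    "(nat \<Rightarrow> ('g, 'c) monoid_scheme) \<Rightarrow> (nat \<Rightarrow> nat \<Rightarrow> 'g \<Rightarrow> 'g) \<Rightarrow>
     ('h, 'd) monoid_scheme \<Rightarrow> (nat \<Rightarrow> 'g \<Rightarrow> 'h) \<Rightarrow> bool" where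
  "direct_pre_limit \<Phi> \<eta> \<Phi>\<^sub>L \<eta>\<^sub>L \<longleftrightarrow>
     group \<Phi>\<^sub>L \<and>
     (\<forall>n\<ge>1. \<eta>\<^sub>L n \<in> hom (\<Phi> n) \<Phi>\<^sub>L) \<and>
     (\<forall>n\<ge>1. \<forall>m\<ge>n. \<forall>\<phi>\<in>carrier (\<Phi> n). \<eta>\<^sub>L n \<phi> = \<eta>\<^sub>L m (\<eta> n m \<phi>))"

definition compatible_direct_system ::
    "'a topology \<Rightarrow> (nat \<Rightarrow> 'a set) \<Rightarrow> (nat \<Rightarrow> ('g, 'c) monoid_scheme) \<Rightarrow>
     (nat \<Rightarrow> nat \<Rightarrow> 'g \<Rightarrow> 'g) \<Rightarrow> (nat \<Rightarrow> 'g \<Rightarrow> 'a \<Rightarrow> 'a) \<Rightarrow> bool" where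
  "compatible_direct_system X S \<Phi> \<eta> a \<longleftrightarrow>
     direct_system \<Phi> \<eta> \<and>
     (\<forall>n\<ge>1. acts_on_counting_measures (\<Phi> n) (subtopology X (S n)) (a n)) \<and>
     (\<forall>n\<ge>1. \<forall>m\<ge>n. \<forall>\<phi>\<in>carrier (\<Phi> n). \<forall>\<xi>\<in>counting_measures (subtopology X (S m)).
        restrict_space (extended_action (subtopology X (S m)) (a m) (\<eta> n m \<phi>) \<xi>) (S n) =
        extended_action (subtopology X (S n)) (a n) \<phi> (restrict_space \<xi> (S n)))"

definition compatible_direct_pre_limit ::
    "'a topology \<Rightarrow> (nat \<Rightarrow> 'a set) \<Rightarrow> (nat \<Rightarrow> ('g, 'c) monoid_scheme) \<Rightarrow>
     (nat \<Rightarrow> nat \<Rightarrow> 'g \<Rightarrow> 'g) \<Rightarrow> (nat \<Rightarrow> 'g \<Rightarrow> 'a \<Rightarrow> 'a) \<Rightarrow>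
     ('h, 'd) monoid_scheme \<Rightarrow> (nat \<Rightarrow> 'g \<Rightarrow> 'h) \<Rightarrow> ('h \<Rightarrow> 'a \<Rightarrow> 'a) \<Rightarrow> bool" where
  "compatible_direct_pre_limit X S \<Phi> \<eta> a \<Phi>\<^sub>L \<eta>\<^sub>L a\<^sub>L \<longleftrightarrow>
     direct_pre_limit \<Phi> \<eta> \<Phi>\<^sub>L \<eta>\<^sub>L \<and>
     acts_on_counting_measures \<Phi>\<^sub>L X a\<^sub>L \<and>
     (\<forall>n\<ge>1. \<forall>\<phi>\<in>carrier (\<Phi> n). \<forall>\<xi>\<in>counting_measures X.
        restrict_space (extended_action X a\<^sub>L (\<eta>\<^sub>L n \<phi>) \<xi>) (S n) =
        extended_action (subtopology X (S n)) (a n) \<phi> (restrict_space \<xi> (S n)))"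

end

theory Submission
  imports Defs
begin

text \<open>Since \<open>\<xi>(A)\<close> is the supremum of the \<open>\<xi>(A \<inter> S m)\<close>, the events that depend only on the
  restriction of \<open>\<xi>\<close> to some \<open>S m\<close> generate the \<open>\<sigma>\<close>-algebra of \<open>M(X)\<close>; they form a
  \<open>\<pi>\<close>-system because \<open>S\<close> is non-decreasing. Let \<open>\<phi>\<close> belong to the \<open>n\<close>-th group. On such an
  event with \<open>m \<ge> n\<close>, the relation \<open>\<eta>\<^sub>L n \<phi> = \<eta>\<^sub>L m (\<eta> n m \<phi>)\<close> and compatibility turn
  the action of \<open>\<phi>\<close> on \<open>M(X)\<close> into that of \<open>\<eta> n m \<phi>\<close> on \<open>M(S m)\<close>, so invariance of the
  limit under \<open>\<phi>\<close> is invariance of \<open>\<mu> m\<close> under \<open>\<eta> n m \<phi>\<close>.\<close>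

section \<open>Borel sets of a topology and of its open subspaces\<close>

lemma space_borel_of [simp]: "space (borel_of Y) = topspace Y"
  unfolding borel_of_def by (rule space_measure_of) (use openin_subset in auto)

lemma sets_borel_of: "sets (borel_of Y) = sigma_sets (topspace Y) {U. openin Y U}"
  unfolding borel_of_def by (rule sets_measure_of) (use openin_subset in auto)

lemma openin_borel_of: "openin Y U \<Longrightarrow> U \<in> sets (borel_of Y)"
  by (auto simp: sets_borel_of)

text \<open>Taking traces on a measurable set commutes with generating a \<sigma>-algebra, and the
  traces of the open sets on \<open>U\<close> are the open sets of the subspace.\<close>

lemma sets_borel_of_subtopology:
  assumes "openin Y U"
  shows "sets (borel_of (subtopology Y U)) = (\<inter>) U ` sets (borel_of Y)"
proof -
  have U: "U \<subseteq> topspace Y"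
    by (rule openin_subset[OF assms])
  have "{V. openin (subtopology Y U) V} = (\<inter>) U ` {V. openin Y V}"
    by (auto simp: openin_subtopology Int_commute)
  moreover have "(\<inter>) U ` sigma_sets (topspace Y) {V. openin Y V} =
      sigma_sets U ((\<inter>) U ` {V. openin Y V})"
    by (rule sigma_sets_Int) (use openin_borel_of[OF assms] U in \<open>auto simp: sets_borel_of\<close>)
  ultimately show ?thesis
    using U by (simp add: sets_borel_of Int_absorb1)
qed

section \<open>The \<sigma>-algebra on the space of counting measures\<close>

lemma space_counting_algebra [simp]: "space (counting_algebra Y) = counting_measures Y"
  unfolding counting_algebra_def by (rule space_measure_of) auto

lemma counting_measuresD:
  assumes "\<xi> \<in> counting_measures Y"
  shows "sets \<xi> = sets (borel_of Y)" "space \<xi> = topspace Y"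
  using assms sets_eq_imp_space_eq[of \<xi> "borel_of Y"] by (auto simp: counting_measures_def)

lemma measurable_emeasure_counting_algebra:
  assumes "A \<in> sets (borel_of Y)"
  shows "(\<lambda>\<xi>. emeasure \<xi> A) \<in> borel_measurable (counting_algebra Y)"
proof (rule measurableI)
  fix B :: "ennreal set" assume "B \<in> sets borel"
  then have "{\<xi> \<in> counting_measures Y. emeasure \<xi> A \<in> B} \<in> sets (counting_algebra Y)"
    using assms unfolding counting_algebra_def by (subst sets_measure_of) auto
  then show "(\<lambda>\<xi>. emeasure \<xi> A) -` B \<inter> space (counting_algebra Y) \<in> sets (counting_algebra Y)"
    by (simp add: vimage_def Int_def conj_commute)
qed auto

text \<open>The generators of \<open>counting_algebra Y\<close> are preimages under evaluations, so
  measurability of a map into it can be tested on each evaluation. The measurability proofs for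
  restriction, group action and identity below all go through this test.\<close>

lemma measurable_counting_algebraI:
  assumes "\<And>x. x \<in> space N \<Longrightarrow> f x \<in> counting_measures Y"
    and "\<And>A. A \<in> sets (borel_of Y) \<Longrightarrow> (\<lambda>x. emeasure (f x) A) \<in> borel_measurable N"
  shows "f \<in> measurable N (counting_algebra Y)"
  unfolding counting_algebra_def
proof (rule measurable_measure_of)
  fix C assume "C \<in> {{\<xi> \<in> counting_measures Y. emeasure \<xi> A \<in> B} | A B.
    A \<in> sets (borel_of Y) \<and> B \<in> sets borel}"
  then obtain A B where C: "C = {\<xi> \<in> counting_measures Y. emeasure \<xi> A \<in> B}"
    and A: "A \<in> sets (borel_of Y)" and B: "B \<in> sets borel"
    by blast
  have "f -` C \<inter> space N = (\<lambda>x. emeasure (f x) A) -` B \<inter> space N"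
    using assms(1) by (auto simp: C)
  then show "f -` C \<inter> space N \<in> sets N"
    using measurable_sets[OF assms(2)[OF A] B] by simp
qed (use assms(1) in auto)

section \<open>Restriction to an open subset, and the extended action\<close>

lemma emeasure_restrict_counting_measure:
  assumes "openin Y U" "\<xi> \<in> counting_measures Y" "A \<subseteq> U"
  shows "emeasure (restrict_space \<xi> U) A = emeasure \<xi> A"
proof (rule emeasure_restrict_space)
  show "U \<inter> space \<xi> \<in> sets \<xi>"
    using assms counting_measuresD[OF assms(2)] openin_subset[OF assms(1)] openin_borel_of[OF assms(1)]
    by (simp add: Int_absorb2)
qed fact

text \<open>Openness of \<open>U\<close> makes its Borel sets Borel in \<open>Y\<close>, and
  restriction keeps their masses, so the conditions are inherited. Only local finiteness needs a new
  witness: the old neighbourhood cut down to \<open>U\<close>.\<close>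

lemma restrict_counting_measures:
  assumes U: "openin Y U" and \<xi>: "\<xi> \<in> counting_measures Y"
  shows "restrict_space \<xi> U \<in> counting_measures (subtopology Y U)"
proof -
  note e = emeasure_restrict_counting_measure[OF assms]
  have UY: "U \<subseteq> topspace Y"
    by (rule openin_subset[OF U])
  have sub: "A \<subseteq> U \<and> A \<in> sets (borel_of Y)" if "A \<in> sets (borel_of (subtopology Y U))" for A
    using that openin_borel_of[OF U] by (auto simp: sets_borel_of_subtopology[OF U])
  have "sets (restrict_space \<xi> U) = sets (borel_of (subtopology Y U))"
    using \<xi> by (simp add: sets_borel_of_subtopology[OF U] sets_restrict_space counting_measuresD)
  moreover have "emeasure (restrict_space \<xi> U) A \<in> insert \<infinity> (range of_nat)"
    if "A \<in> sets (borel_of (subtopology Y U))" for A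
    using \<xi> sub[OF that] e[of A] unfolding counting_measures_def by auto
  moreover have "\<exists>V. openin (subtopology Y U) V \<and> y \<in> V \<and> emeasure (restrict_space \<xi> U) V < \<infinity>"
    if "y \<in> topspace (subtopology Y U)" for y
  proof -
    from that \<xi> obtain V where V: "openin Y V" "y \<in> V" "emeasure \<xi> V < \<infinity>"
      unfolding counting_measures_def by auto
    have "emeasure \<xi> (V \<inter> U) \<le> emeasure \<xi> V"
      by (rule emeasure_mono) (use V \<xi> in \<open>auto simp: counting_measuresD openin_borel_of\<close>)
    then have "emeasure (restrict_space \<xi> U) (V \<inter> U) < \<infinity>"
      using V e[of "V \<inter> U"] by (auto intro: le_less_trans)
    then show ?thesis
      using V that by (intro exI[of _ "V \<inter> U"]) (auto simp: openin_subtopology)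
  qed
  moreover have "emeasure (restrict_space \<xi> U) {y} \<le> 1" if "y \<in> topspace (subtopology Y U)" for y
    using that \<xi> e[of "{y}"] unfolding counting_measures_def by auto
  ultimately show ?thesis
    unfolding counting_measures_def by blast
qed

lemma measurable_restrict_counting_measure:
  assumes U: "openin Y U"
  shows "(\<lambda>\<xi>. restrict_space \<xi> U) \<in> measurable (counting_algebra Y) (counting_algebra (subtopology Y U))"
proof (rule measurable_counting_algebraI)
  fix A assume "A \<in> sets (borel_of (subtopology Y U))"
  then have A: "A \<subseteq> U" "A \<in> sets (borel_of Y)"
    using openin_borel_of[OF U] by (auto simp: sets_borel_of_subtopology[OF U])
  show "(\<lambda>\<xi>. emeasure (restrict_space \<xi> U) A) \<in> borel_measurable (counting_algebra Y)"
    by (subst measurable_cong[where g = "\<lambda>\<xi>. emeasure \<xi> A"])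
      (use A U in \<open>auto simp: emeasure_restrict_counting_measure measurable_emeasure_counting_algebra\<close>)
qed (simp add: restrict_counting_measures[OF U])

text \<open>Evaluating at \<open>A\<close> after the action is evaluating at the preimage of
  \<open>A\<close> under \<open>a g\<close>, which is Borel because the action is
  measurable.\<close>

lemma measurable_extended_action:
  assumes "acts_on_counting_measures G Y a" and g: "g \<in> carrier G"
  shows "extended_action Y a g \<in> measurable (counting_algebra Y) (counting_algebra Y)"
proof (rule measurable_counting_algebraI)
  show "extended_action Y a g \<xi> \<in> counting_measures Y" if "\<xi> \<in> space (counting_algebra Y)" for \<xi>
    using assms that unfolding acts_on_counting_measures_def by simp
  have ag: "a g \<in> measurable (borel_of Y) (borel_of Y)"
    using assms unfolding acts_on_counting_measures_def acts_measurably_def by blast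
  fix A assume A: "A \<in> sets (borel_of Y)"
  have "emeasure (extended_action Y a g \<xi>) A = emeasure \<xi> (a g -` A \<inter> topspace Y)"
    if "\<xi> \<in> counting_measures Y" for \<xi>
  proof -
    have "a g \<in> measurable \<xi> (borel_of Y)"
      using ag counting_measuresD(1)[OF that] measurable_cong_sets by blast
    then show ?thesis
      unfolding extended_action_def by (simp add: emeasure_distr A counting_measuresD(2)[OF that])
  qed
  then show "(\<lambda>\<xi>. emeasure (extended_action Y a g \<xi>) A) \<in> borel_measurable (counting_algebra Y)"
    by (subst measurable_cong[where g = "\<lambda>\<xi>. emeasure \<xi> (a g -` A \<inter> topspace Y)"])
      (use measurable_sets[OF ag A] in \<open>auto intro!: measurable_emeasure_counting_algebra\<close>)
qed

section \<open>Cylinder events generate and determine measures\<close>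

definition cylinders :: "'a topology \<Rightarrow> (nat \<Rightarrow> 'a set) \<Rightarrow> 'a measure set set" where
  "cylinders Y U = {{\<xi> \<in> counting_measures Y. restrict_space \<xi> (U n) \<in> B} | n B.
     B \<in> sets (counting_algebra (subtopology Y (U n)))}"

text \<open>The witness is the preimage of \<open>B\<close> under the projection from level
  \<open>m\<close> to level \<open>n\<close>. It describes the same event because restricting in two
  stages equals restricting at once.\<close>

lemma cylinders_lift:
  assumes U: "\<And>n. openin Y (U n)" "mono U" and "n \<le> m"
    and B: "B \<in> sets (counting_algebra (subtopology Y (U n)))"
  obtains C where "C \<in> sets (counting_algebra (subtopology Y (U m)))"
    "{\<xi> \<in> counting_measures Y. restrict_space \<xi> (U n) \<in> B} =
     {\<xi> \<in> counting_measures Y. restrict_space \<xi> (U m) \<in> C}"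
proof
  let ?C = "(\<lambda>\<xi>. restrict_space \<xi> (U n)) -` B \<inter> space (counting_algebra (subtopology Y (U m)))"
  have nm: "U n \<subseteq> U m"
    using \<open>mono U\<close> \<open>n \<le> m\<close> by (rule monoD)
  then have "openin (subtopology Y (U m)) (U n)"
    using U(1) by (simp add: openin_open_subtopology)
  then have "(\<lambda>\<xi>. restrict_space \<xi> (U n)) \<in> measurable (counting_algebra (subtopology Y (U m)))
      (counting_algebra (subtopology Y (U n)))"
    using measurable_restrict_counting_measure[of "subtopology Y (U m)" "U n"] nm
    by (simp add: subtopology_subtopology Int_absorb1)
  then show "?C \<in> sets (counting_algebra (subtopology Y (U m)))"
    using B by (rule measurable_sets)
  have "restrict_space (restrict_space \<xi> (U m)) (U n) = restrict_space \<xi> (U n)"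
    if "\<xi> \<in> counting_measures Y" for \<xi>
    using that nm openin_borel_of[OF U(1)] openin_subset[OF U(1)]
    by (subst restrict_restrict_space) (auto simp: counting_measuresD Int_absorb1 Int_absorb2)
  then show "{\<xi> \<in> counting_measures Y. restrict_space \<xi> (U n) \<in> B} =
     {\<xi> \<in> counting_measures Y. restrict_space \<xi> (U m) \<in> ?C}"
    using restrict_counting_measures[OF U(1)] by auto
qed

lemma Int_stable_cylinders:
  assumes U: "\<And>n. openin Y (U n)" "mono U"
  shows "Int_stable (cylinders Y U)"
proof (rule Int_stableI)
  fix E F assume "E \<in> cylinders Y U" "F \<in> cylinders Y U"
  then obtain n B m C where
    E: "E = {\<xi> \<in> counting_measures Y. restrict_space \<xi> (U n) \<in> B}"
      "B \<in> sets (counting_algebra (subtopology Y (U n)))" and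
    F: "F = {\<xi> \<in> counting_measures Y. restrict_space \<xi> (U m) \<in> C}"
      "C \<in> sets (counting_algebra (subtopology Y (U m)))"
    unfolding cylinders_def by blast
  let ?k = "max n m"
  obtain B' where B': "B' \<in> sets (counting_algebra (subtopology Y (U ?k)))"
    "E = {\<xi> \<in> counting_measures Y. restrict_space \<xi> (U ?k) \<in> B'}"
    using cylinders_lift[OF U max.cobounded1 E(2)] E(1) by metis
  obtain C' where C': "C' \<in> sets (counting_algebra (subtopology Y (U ?k)))"
    "F = {\<xi> \<in> counting_measures Y. restrict_space \<xi> (U ?k) \<in> C'}"
    using cylinders_lift[OF U max.cobounded2 F(2)] F(1) by metis
  have "E \<inter> F = {\<xi> \<in> counting_measures Y. restrict_space \<xi> (U ?k) \<in> B' \<inter> C'}"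
    using B' C' by auto
  then show "E \<inter> F \<in> cylinders Y U"
    using sets.Int[OF B'(1) C'(1)] unfolding cylinders_def by blast
qed

text \<open>Provides the exhausting sequence, here constant, that uniqueness of measures on a
  generator requires.\<close>

lemma counting_measures_in_cylinders:
  assumes U: "\<And>n. openin Y (U n)"
  shows "counting_measures Y \<in> cylinders Y U"
proof -
  have "counting_measures Y =
      {\<xi> \<in> counting_measures Y. restrict_space \<xi> (U 0) \<in> space (counting_algebra (subtopology Y (U 0)))}"
    using restrict_counting_measures[OF U] by auto
  then show ?thesis
    unfolding cylinders_def by blast
qed

lemma sets_counting_algebra_cylinders:
  assumes U: "\<And>n. openin Y (U n)" "mono U" and cover: "(\<Union>n. U n) = topspace Y"
  shows "sets (counting_algebra Y) = sigma_sets (counting_measures Y) (cylinders Y U)"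
proof
  let ?N = "sigma (counting_measures Y) (cylinders Y U)"
  have Pow: "cylinders Y U \<subseteq> Pow (counting_measures Y)"
    unfolding cylinders_def by blast
  have N: "space ?N = counting_measures Y" "sets ?N = sigma_sets (counting_measures Y) (cylinders Y U)"
    using Pow by (auto intro: space_measure_of sets_measure_of)
  have restr: "(\<lambda>\<xi>. restrict_space \<xi> (U n)) \<in> measurable ?N (counting_algebra (subtopology Y (U n)))" for n
  proof (rule measurableI)
    fix B assume "B \<in> sets (counting_algebra (subtopology Y (U n)))"
    then have "{\<xi> \<in> counting_measures Y. restrict_space \<xi> (U n) \<in> B} \<in> cylinders Y U"
      unfolding cylinders_def by blast
    then show "(\<lambda>\<xi>. restrict_space \<xi> (U n)) -` B \<inter> space ?N \<in> sets ?N"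
      unfolding N by (simp add: vimage_def Int_def conj_commute)
  qed (use N restrict_counting_measures[OF U(1)] in auto)
  \<comment> \<open>Measurability of the identity is the inclusion of \<sigma>-algebras in disguise.
    In this form it can be tested on evaluations, each a countable supremum of functions that factor
    through the restrictions \<open>restr\<close>.\<close>
  have "(\<lambda>\<xi>. \<xi>) \<in> measurable ?N (counting_algebra Y)"
  proof (rule measurable_counting_algebraI)
    fix A assume A: "A \<in> sets (borel_of Y)"
    have AU: "U n \<inter> A \<in> sets (borel_of (subtopology Y (U n)))" for n
      using A by (simp add: sets_borel_of_subtopology[OF U(1)])
    have "emeasure \<xi> A = (SUP n. emeasure (restrict_space \<xi> (U n)) (U n \<inter> A))"
      if "\<xi> \<in> counting_measures Y" for \<xi>
    proof -
      have "(SUP n. emeasure \<xi> (U n \<inter> A)) = emeasure \<xi> (\<Union>n. U n \<inter> A)"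
        by (rule SUP_emeasure_incseq)
          (use A that U openin_borel_of[OF U(1)] in
            \<open>auto simp: counting_measuresD incseq_def mono_def\<close>)
      also have "(\<Union>n. U n \<inter> A) = A"
        using cover sets.sets_into_space[OF A] by auto
      finally show ?thesis
        using that by (simp add: emeasure_restrict_counting_measure[OF U(1)])
    qed
    moreover have "(\<lambda>\<xi>. SUP n. emeasure (restrict_space \<xi> (U n)) (U n \<inter> A)) \<in> borel_measurable ?N"
      by (intro borel_measurable_SUP measurable_compose[OF restr]
          measurable_emeasure_counting_algebra AU) auto
    ultimately show "(\<lambda>\<xi>. emeasure \<xi> A) \<in> borel_measurable ?N"
      using N(1) by (subst measurable_cong) auto
  qed (simp add: N)
  then show "sets (counting_algebra Y) \<subseteq> sigma_sets (counting_measures Y) (cylinders Y U)"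
  proof (intro subsetI)
    fix A assume id: "(\<lambda>\<xi>. \<xi>) \<in> measurable ?N (counting_algebra Y)"
      and A: "A \<in> sets (counting_algebra Y)"
    have "(\<lambda>\<xi>. \<xi>) -` A \<inter> space ?N = A"
      using sets.sets_into_space[OF A] N(1) by auto
    then show "A \<in> sigma_sets (counting_measures Y) (cylinders Y U)"
      using measurable_sets[OF id A] N(2) by simp
  qed
  have "cylinders Y U \<subseteq> sets (counting_algebra Y)"
  proof
    fix E assume "E \<in> cylinders Y U"
    then obtain n B where E: "E = {\<xi> \<in> counting_measures Y. restrict_space \<xi> (U n) \<in> B}"
      and B: "B \<in> sets (counting_algebra (subtopology Y (U n)))"
      unfolding cylinders_def by blast
    show "E \<in> sets (counting_algebra Y)"
      using measurable_sets[OF measurable_restrict_counting_measure[OF U(1)] B]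
      by (simp add: E vimage_def Int_def conj_commute)
  qed
  then show "sigma_sets (counting_measures Y) (cylinders Y U) \<subseteq> sets (counting_algebra Y)"
    using sets.sigma_sets_subset[of "cylinders Y U" "counting_algebra Y"] by simp
qed

text \<open>Uniqueness on a generating \<pi>-system. Finiteness is asked of \<open>M\<close> alone,
  since \<open>eq\<close> carries it over to \<open>N\<close>; this suits the use below, where
  \<open>N\<close> is a push-forward of \<open>M\<close>.\<close>

lemma prob_measure_eqI_cylinders:
  assumes U: "\<And>n. openin Y (U n)" "mono U" "(\<Union>n. U n) = topspace Y"
    and "prob_space M" "sets M = sets (counting_algebra Y)" "sets N = sets (counting_algebra Y)"
    and eq: "\<And>E. E \<in> cylinders Y U \<Longrightarrow> emeasure M E = emeasure N E"
  shows "M = N"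
proof (rule measure_eqI_generator_eq)
  show "Int_stable (cylinders Y U)"
    using U(1,2) by (rule Int_stable_cylinders)
  show "cylinders Y U \<subseteq> Pow (counting_measures Y)"
    unfolding cylinders_def by blast
  show "range (\<lambda>_::nat. counting_measures Y) \<subseteq> cylinders Y U"
    using counting_measures_in_cylinders[OF U(1)] by auto
  show "emeasure M (counting_measures Y) \<noteq> \<infinity>" for i :: nat
    using prob_space.emeasure_le_1[OF \<open>prob_space M\<close>, of "counting_measures Y"]
    by (auto simp: top_unique)
qed (use assms sets_counting_algebra_cylinders[OF U] in auto)

section \<open>Invariance of the projective limit\<close>

theorem theorem3p3:
  fixes X :: "'a topology"
    and S :: "nat \<Rightarrow> 'a set"
    and \<mu> :: "nat \<Rightarrow> 'a measure measure"
    and \<mu>\<^sub>N :: "'a measure measure"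
    and \<Phi> :: "nat \<Rightarrow> ('g, 'c) monoid_scheme"
    and \<eta> :: "nat \<Rightarrow> nat \<Rightarrow> 'g \<Rightarrow> 'g"
    and a :: "nat \<Rightarrow> 'g \<Rightarrow> 'a \<Rightarrow> 'a"
    and \<Phi>\<^sub>L :: "('h, 'd) monoid_scheme"
    and \<eta>\<^sub>L :: "nat \<Rightarrow> 'g \<Rightarrow> 'h"
    and a\<^sub>L :: "'h \<Rightarrow> 'a \<Rightarrow> 'a"
  assumes "polish_topology X"
    and "\<And>n. n \<ge> 1 \<Longrightarrow> openin X (S n)"
    and "\<And>n m. 1 \<le> n \<Longrightarrow> n \<le> m \<Longrightarrow> S n \<subseteq> S m"
    and "(\<Union>n\<in>{1..}. S n) = topspace X"
    and "projective_system X S \<mu>"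
    and "projective_limit X S \<mu> \<mu>\<^sub>N"
    and "compatible_direct_system X S \<Phi> \<eta> a"
    and "compatible_direct_pre_limit X S \<Phi> \<eta> a \<Phi>\<^sub>L \<eta>\<^sub>L a\<^sub>L"
    and "\<And>\<nu>. prob_space \<nu> \<Longrightarrow> sets \<nu> = sets (counting_algebra X) \<Longrightarrow>
           (\<forall>n\<ge>1. \<forall>\<phi>\<in>carrier (\<Phi> n). \<forall>A\<in>sets (counting_algebra X).
              emeasure \<nu> A = emeasure \<nu> (extended_action X a\<^sub>L (\<eta>\<^sub>L n \<phi>) -` A \<inter> space \<nu>)) \<Longrightarrow>
           invariant_under \<Phi>\<^sub>L (extended_action X a\<^sub>L) \<nu>"
    and "\<And>n. n \<ge> 1 \<Longrightarrow>
           invariant_under (\<Phi> n) (extended_action (subtopology X (S n)) (a n)) (\<mu> n)"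
  shows "invariant_under \<Phi>\<^sub>L (extended_action X a\<^sub>L) \<mu>\<^sub>N"
\<comment> \<open>By the hypothesis on the pre-limit group, it is enough to treat the elements
  \<open>\<eta>\<^sub>L n \<phi>\<close>.\<close>
proof (rule assms(9))
  have pp: "point_process X \<mu>\<^sub>N"
    using assms(6) unfolding projective_limit_def by blast
  then show prob: "prob_space \<mu>\<^sub>N" and sets_\<mu>: "sets \<mu>\<^sub>N = sets (counting_algebra X)"
    unfolding point_process_def by auto
  have space_\<mu>: "space \<mu>\<^sub>N = counting_measures X"
    using sets_eq_imp_space_eq[OF sets_\<mu>] by simp
  have lim: "distr \<mu>\<^sub>N (counting_algebra (subtopology X (S m))) (\<lambda>\<xi>. restrict_space \<xi> (S m)) = \<mu> m"
    if "m \<ge> 1" for m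
    using assms(6) that unfolding projective_limit_def by blast
  have sys: "direct_system \<Phi> \<eta>"
    using assms(7) unfolding compatible_direct_system_def by blast
  have pre: "direct_pre_limit \<Phi> \<eta> \<Phi>\<^sub>L \<eta>\<^sub>L" and actL: "acts_on_counting_measures \<Phi>\<^sub>L X a\<^sub>L"
    using assms(8) unfolding compatible_direct_pre_limit_def by auto
  have act: "acts_on_counting_measures (\<Phi> m) (subtopology X (S m)) (a m)" if "m \<ge> 1" for m
    using assms(7) that unfolding compatible_direct_system_def by blast
  have compat: "restrict_space (extended_action X a\<^sub>L (\<eta>\<^sub>L m \<psi>) \<xi>) (S m) =
      extended_action (subtopology X (S m)) (a m) \<psi> (restrict_space \<xi> (S m))"
    if "m \<ge> 1" "\<psi> \<in> carrier (\<Phi> m)" "\<xi> \<in> counting_measures X" for m \<psi> \<xi>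
    using assms(8) that unfolding compatible_direct_pre_limit_def by blast
  show "\<forall>n\<ge>1. \<forall>\<phi>\<in>carrier (\<Phi> n). \<forall>A\<in>sets (counting_algebra X).
      emeasure \<mu>\<^sub>N A = emeasure \<mu>\<^sub>N (extended_action X a\<^sub>L (\<eta>\<^sub>L n \<phi>) -` A \<inter> space \<mu>\<^sub>N)"
  proof (intro allI impI ballI)
    fix n :: nat and \<phi> A
    assume n: "n \<ge> 1" and \<phi>: "\<phi> \<in> carrier (\<Phi> n)" and A: "A \<in> sets (counting_algebra X)"
    let ?F = "extended_action X a\<^sub>L (\<eta>\<^sub>L n \<phi>)"
    \<comment> \<open>dropping the first sets makes every cylinder live at a level to which \<open>\<phi>\<close> can be lifted\<close>
    let ?U = "\<lambda>k. S (n + k)"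
    have "\<eta>\<^sub>L n \<phi> \<in> carrier \<Phi>\<^sub>L"
      using pre n \<phi> unfolding direct_pre_limit_def hom_def by blast
    then have F: "?F \<in> measurable \<mu>\<^sub>N (counting_algebra X)"
      using measurable_extended_action[OF actL] measurable_cong_sets[OF sets_\<mu> refl] by blast
    have U: "openin X (?U k)" for k
      using assms(2) n by simp
    have "mono ?U"
      using assms(3) n by (intro monoI) simp
    \<comment> \<open>The shifted sequence still exhausts \<open>X\<close>, as \<open>S m\<close>
      lies in \<open>S (n + m)\<close>.\<close>
    have "S m \<subseteq> ?U m" if "1 \<le> m" for m
      using assms(3) that by simp
    then have cover: "(\<Union>k. ?U k) = topspace X"
      using assms(4) openin_subset[OF U] by (fastforce simp: set_eq_iff)
    \<comment> \<open>Invariance under a single element says that \<open>\<mu>\<^sub>N\<close>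
      equals its push-forward. Comparing two measures makes the uniqueness lemma applicable, so only
      cylinders remain.\<close>
    have "\<mu>\<^sub>N = distr \<mu>\<^sub>N (counting_algebra X) ?F"
    proof (rule prob_measure_eqI_cylinders[OF U \<open>mono ?U\<close> cover prob sets_\<mu>])
      fix E assume "E \<in> cylinders X ?U"
      then obtain k B where E: "E = {\<xi> \<in> counting_measures X. restrict_space \<xi> (?U k) \<in> B}"
        and B: "B \<in> sets (counting_algebra (subtopology X (?U k)))"
        unfolding cylinders_def by blast
      define m where "m = n + k"
      let ?M = "counting_algebra (subtopology X (S m))"
      let ?r = "\<lambda>\<xi>. restrict_space \<xi> (S m)"
      have m: "1 \<le> m" "n \<le> m" and B: "B \<in> sets ?M"
        using n B by (auto simp: m_def)
      \<comment> \<open>The cylinder lives at level \<open>m\<close>, where \<open>\<phi>\<close>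
        itself does not act. Its image \<open>\<psi>\<close> does, and it has the same image in
        \<open>\<Phi>\<^sub>L\<close>.\<close>
      define \<psi> where "\<psi> = \<eta> n m \<phi>"
      have \<psi>: "\<psi> \<in> carrier (\<Phi> m)"
        using sys n m \<phi> unfolding direct_system_def hom_def \<psi>_def by blast
      have \<eta>: "\<eta>\<^sub>L n \<phi> = \<eta>\<^sub>L m \<psi>"
        using pre n m \<phi> unfolding direct_pre_limit_def \<psi>_def by blast
      let ?f = "extended_action (subtopology X (S m)) (a m) \<psi>"
      have f: "?f \<in> measurable ?M ?M"
        using act[OF m(1)] \<psi> by (rule measurable_extended_action)
      have r: "?r \<in> measurable \<mu>\<^sub>N ?M"
        using measurable_restrict_counting_measure[OF assms(2)[OF m(1)]]
          measurable_cong_sets[OF sets_\<mu> refl] by blast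
      \<comment> \<open>The projective limit property, used in both directions: to pass from
        \<open>\<mu>\<^sub>N\<close> down to \<open>\<mu> m\<close>, and back after invariance has
        been applied.\<close>
      have \<mu>m: "emeasure (\<mu> m) C = emeasure \<mu>\<^sub>N (?r -` C \<inter> space \<mu>\<^sub>N)" if "C \<in> sets ?M" for C
        using that by (simp add: lim[OF m(1), symmetric] emeasure_distr[OF r])
      have sets_m: "sets (\<mu> m) = sets ?M" and space_m: "space (\<mu> m) = space ?M"
        by (simp_all add: lim[OF m(1), symmetric])
      have E': "E = ?r -` B \<inter> space \<mu>\<^sub>N"
        by (auto simp: E space_\<mu> m_def)
      then have ES: "E \<in> sets (counting_algebra X)"
        using measurable_sets[OF r B] sets_\<mu> by simp
      have "emeasure \<mu>\<^sub>N E = emeasure (\<mu> m) B"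
        by (simp add: E' \<mu>m[OF B])
      also have "\<dots> = emeasure (\<mu> m) (?f -` B \<inter> space ?M)"
        using assms(10)[OF m(1)] \<psi> B unfolding invariant_under_def sets_m space_m by blast
      also have "\<dots> = emeasure \<mu>\<^sub>N (?r -` (?f -` B \<inter> space ?M) \<inter> space \<mu>\<^sub>N)"
        using measurable_sets[OF f B] by (rule \<mu>m)
      \<comment> \<open>Compatibility at level \<open>m\<close>: projecting and then acting by
        \<open>\<psi>\<close> gives the same measure as acting by
        \<open>\<eta>\<^sub>L m \<psi>\<close> and then projecting. The
        \<open>measurable_space\<close> facts keep the images in the spaces over which preimages are
        taken.\<close>
      also have "?r -` (?f -` B \<inter> space ?M) \<inter> space \<mu>\<^sub>N = ?F -` E \<inter> space \<mu>\<^sub>N"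
        using compat[OF m(1) \<psi>] measurable_space[OF r] measurable_space[OF F]
        by (auto simp: E' \<eta> space_\<mu>)
      also have "emeasure \<mu>\<^sub>N (?F -` E \<inter> space \<mu>\<^sub>N) = emeasure (distr \<mu>\<^sub>N (counting_algebra X) ?F) E"
        using emeasure_distr[OF F ES] by simp
      finally show "emeasure \<mu>\<^sub>N E = emeasure (distr \<mu>\<^sub>N (counting_algebra X) ?F) E" .
    qed simp
    then show "emeasure \<mu>\<^sub>N A = emeasure \<mu>\<^sub>N (?F -` A \<inter> space \<mu>\<^sub>N)"
      using emeasure_distr[OF F A] by simp
  qed
qed

end
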